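(* For integers $k\ge1$ and $N\ge k+3$, $$W_1^*(N,k)=\theta^2P_{N-2}\,W_1^*(N-1,k)+\sum_{i=k+1}^{N-1}\theta^{N-i-1}\,T_1(i-1,k)\,B(i-1,N-i-1)\,(P_{N-i-1})!,$$ with initial conditions $W_1^*(k+1,k)=0$ and $W_1^*(k+2,k)=(P_k)!$.
   Context: Let $\theta>0$. $\mathrm{inv}(\pi)$ is the number of pairs $i<j$ with $\pi_i>\pi_j$. $P_n=1+\theta+\cdots+\theta^{n-1}$, $(P_n)!=P_n\cdots P_1$, $(P_0)!=1$. $B(n,m)=\sum\theta^{\#\{(a,b):a\in\Pi_1,b\in\Pi_2,a>b\}}$ over all ordered partitions $(\Pi_1,\Pi_2)$ of $\{1,\dots,n+m\}$ with $|\Pi_1|=n,|\Pi_2|=m$. For $\pi\in S_n$, position $i$ is a left-to-right maximum if $\pi_i>\pi_j$ for all $j<i$. The strategy $S^1_k$ rejects the first $k$ candidates and then accepts the first subsequent left-to-right maximum (if any). $\pi\in S_n$ is $k$-pickable if $S^1_k$ makes a selection, and $k$-winnable if $S^1_k$ selects a position holding value $n-1$. $T_1(n,k)=\sum_{\pi\in S_n\text{ not }k\text{-pickable}}\theta^{\mathrm{inv}(\pi)}$ and $W_1^*(n,k)=\sum_{\pi\in S_n\ k\text{-winnable}}\theta^{\mathrm{inv}(\pi)}$. *)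

theory Defs
  imports Complex_Main "HOL-Combinatorics.Permutations"
begin

(* A permutation of size n is a function p with  p permutes {1..n};  p i is the value at
   position i. *)

definition inv_count :: "nat \<Rightarrow> (nat \<Rightarrow> nat) \<Rightarrow> nat" where
  "inv_count n p = card {(i, j). i \<in> {1..n} \<and> j \<in> {1..n} \<and> i < j \<and> p i > p j}"

definition P :: "real \<Rightarrow> nat \<Rightarrow> real" where
  "P \<theta> n = (\<Sum>i<n. \<theta> ^ i)"

definition Pfact :: "real \<Rightarrow> nat \<Rightarrow> real" where
  "Pfact \<theta> n = (\<Prod>i=1..n. P \<theta> i)"

definition ordered_partitions :: "nat \<Rightarrow> nat \<Rightarrow> (nat set \<times> nat set) set" where
  "ordered_partitions n m =
     {(\<Pi>1, \<Pi>2). \<Pi>1 \<union> \<Pi>2 = {1..n + m} \<and> \<Pi>1 \<inter> \<Pi>2 = {} \<and> card \<Pi>1 = n \<and> card \<Pi>2 = m}"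

definition B :: "real \<Rightarrow> nat \<Rightarrow> nat \<Rightarrow> real" where
  "B \<theta> n m =
     (\<Sum>(\<Pi>1, \<Pi>2) \<in> ordered_partitions n m.
        \<theta> ^ card {(a, b). a \<in> \<Pi>1 \<and> b \<in> \<Pi>2 \<and> a > b})"

definition lr_max :: "(nat \<Rightarrow> nat) \<Rightarrow> nat \<Rightarrow> bool" where
  "lr_max p i \<longleftrightarrow> (\<forall>j\<in>{1..<i}. p i > p j)"

(* The position selected by the strategy S^1_k on a permutation of size n; None if no selection
   is made. *)
definition strategy1 :: "nat \<Rightarrow> nat \<Rightarrow> (nat \<Rightarrow> nat) \<Rightarrow> nat option" where
  "strategy1 k n p =
     (if \<exists>i\<in>{k+1..n}. lr_max p i
      then Some (LEAST i. i \<in> {k+1..n} \<and> lr_max p i)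
      else None)"

definition pickable :: "nat \<Rightarrow> nat \<Rightarrow> (nat \<Rightarrow> nat) \<Rightarrow> bool" where
  "pickable k n p \<longleftrightarrow> strategy1 k n p \<noteq> None"

definition winnable :: "nat \<Rightarrow> nat \<Rightarrow> (nat \<Rightarrow> nat) \<Rightarrow> bool" where
  "winnable k n p \<longleftrightarrow> (\<exists>i. strategy1 k n p = Some i \<and> p i = n - 1)"

definition T1 :: "real \<Rightarrow> nat \<Rightarrow> nat \<Rightarrow> real" where
  "T1 \<theta> n k = (\<Sum>p | p permutes {1..n} \<and> \<not> pickable k n p. \<theta> ^ inv_count n p)"

definition W1_star :: "real \<Rightarrow> nat \<Rightarrow> nat \<Rightarrow> real" where
  "W1_star \<theta> n k = (\<Sum>p | p permutes {1..n} \<and> winnable k n p. \<theta> ^ inv_count n p)"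

end

theory Submission
  imports Defs
begin

text \<open>Every permutation of size \<open>n + 1\<close> arises exactly once from a permutation of size \<open>n\<close> by
  appending a last value \<open>v\<close>, which creates \<open>n + 1 - v\<close> new inversions and does not affect the
  left-to-right maxima at earlier positions. In a winnable permutation of size \<open>N\<close> the value
  \<open>N\<close> comes after \<open>N - 1\<close>, so the last value is not \<open>N - 1\<close>. Deleting a last value \<open>v \<le> N - 2\<close>
  leaves a winnable permutation; deleting a last value \<open>N\<close> leaves a permutation on which the
  strategy selects the maximum. The weight of those selecting it at position \<open>i\<close> is found by
  deleting last values until position \<open>i\<close> is last; the resulting product
  \<open>P\<^sub>i \<cdots> P\<^bsub>N-2\<^esub>\<close> equals \<open>B(i-1, N-i-1) (P\<^bsub>N-i-1\<^esub>)!\<close> because \<open>B\<close> is a Gaussian binomial coefficient.\<close>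

section \<open>Appending a last value to a permutation\<close>

definition shift :: "nat \<Rightarrow> nat \<Rightarrow> nat" where
  "shift v x = (if x < v then x else Suc x)"

text \<open>\<open>shift v\<close> is the increasing bijection from the naturals onto the naturals
  other than \<open>v\<close>. It frees the value \<open>v\<close> for position \<open>Suc n\<close>
  and keeps every comparison between earlier positions.\<close>

definition append_value :: "nat \<Rightarrow> nat \<Rightarrow> (nat \<Rightarrow> nat) \<Rightarrow> nat \<Rightarrow> nat" where
  "append_value n v q i = (if i \<le> n then shift v (q i) else if i = Suc n then v else i)"

lemma shift_less_iff [simp]: "shift v x < shift v y \<longleftrightarrow> x < y"
  by (auto simp: shift_def)

lemma shift_eq_iff [simp]: "shift v x = shift v y \<longleftrightarrow> x = y"
  by (auto simp: shift_def)

lemma shift_neq [simp]: "shift v x \<noteq> v"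
  by (auto simp: shift_def)

lemma permutes_le:
  assumes "q permutes {1..n::nat}" "i \<le> n"
  shows "q i \<le> n"
proof (cases "i = 0")
  case True
  then show ?thesis using permutes_not_in[OF assms(1), of 0] by simp
next
  case False
  then have "i \<in> {1..n}" using assms(2) by simp
  then have "q i \<in> {1..n}" using permutes_in_image[OF assms(1), of i] by blast
  then show ?thesis by simp
qed

lemma append_value_permutes:
  assumes q: "q permutes {1..n}" and v: "v \<in> {1..Suc n}"
  shows "append_value n v q permutes {1..Suc n}"
proof -
  \<comment> \<open>Position 0 falls under the branch \<open>i \<le> n\<close>; it stays fixed
    because \<open>q 0 = 0\<close> and 0 lies below \<open>v\<close>.\<close>
  have q0: "q 0 = 0" using permutes_not_in[OF q] by simp
  have "inj_on (append_value n v q) {1..Suc n}"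
    by (auto simp: inj_on_def append_value_def inj_eq[OF permutes_inj[OF q]] shift_neq[symmetric])
  moreover have "append_value n v q ` {1..Suc n} \<subseteq> {1..Suc n}"
  proof (rule image_subsetI)
    fix i assume i: "i \<in> {1..Suc n}"
    show "append_value n v q i \<in> {1..Suc n}"
    proof (cases "i = Suc n")
      case True
      then show ?thesis using v by (simp add: append_value_def)
    next
      case False
      then have "i \<in> {1..n}" using i by simp
      then have "q i \<in> {1..n}" using permutes_in_image[OF q, of i] by blast
      then show ?thesis using \<open>i \<in> {1..n}\<close> by (auto simp: append_value_def shift_def)
    qed
  qed
  ultimately have "bij_betw (append_value n v q) {1..Suc n} {1..Suc n}"
    by (simp add: bij_betw_def endo_inj_surj)
  then show ?thesis
    by (rule bij_imp_permutes) (use q0 v in \<open>auto simp: append_value_def shift_def not_less_eq_eq\<close>)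
qed

text \<open>Surjectivity is a matter of counting, (n+1) * n! = (n+1)!, so no inverse that deletes
  the last value has to be built.\<close>

lemma bij_betw_append_value:
  "bij_betw (\<lambda>(v, q). append_value n v q) ({1..Suc n} \<times> {q. q permutes {1..n}})
     {p. p permutes {1..Suc n}}"
proof -
  let ?f = "\<lambda>(v, q). append_value n v q"
  let ?A = "{1..Suc n} \<times> {q. q permutes {1..n}}"
  let ?C = "{p. p permutes {1..Suc n}}"
  have inj: "inj_on ?f ?A"
  proof (rule inj_onI, clarify)
    fix v q v' q'
    assume q: "q permutes {1..n}" "q' permutes {1..n}"
      and eq: "append_value n v q = append_value n v' q'"
    have v: "v = v'" using fun_cong[OF eq, of "Suc n"] by (simp add: append_value_def)
    have "q i = q' i" for i
    proof (cases "i \<le> n")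
      case True
      then show ?thesis using fun_cong[OF eq, of i] v by (simp add: append_value_def)
    next
      case False
      then show ?thesis using q by (simp add: permutes_not_in)
    qed
    then show "v = v' \<and> q = q'" using v by auto
  qed
  have sub: "?f ` ?A \<subseteq> ?C"
    using append_value_permutes by auto
  have "card (?f ` ?A) = card ?C"
    using card_image[OF inj] card_permutations[of "{1..n}" n]
      card_permutations[of "{1..Suc n}" "Suc n"]
    by (simp add: card_cartesian_product)
  then have "?f ` ?A = ?C"
    using sub by (intro card_subset_eq) (auto simp: finite_permutations)
  with inj show ?thesis by (simp add: bij_betw_def)
qed

text \<open>Old inversions survive because \<open>shift v\<close> is increasing. A shifted value
  exceeds \<open>v\<close> exactly when the old one is at least \<open>v\<close>, so the new
  inversions are counted by \<open>?J\<close>, which \<open>q\<close> maps bijectively onto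
  \<open>{v..n}\<close>.\<close>

lemma inv_count_append_value:
  assumes q: "q permutes {1..n}" and v: "v \<in> {1..Suc n}"
  shows "inv_count (Suc n) (append_value n v q) = inv_count n q + (Suc n - v)"
proof -
  let ?p = "append_value n v q"
  let ?I = "{(i, j). i \<in> {1..n} \<and> j \<in> {1..n} \<and> i < j \<and> q i > q j}"
  let ?J = "{i \<in> {1..n}. v \<le> q i}"
  have eq: "{(i, j). i \<in> {1..Suc n} \<and> j \<in> {1..Suc n} \<and> i < j \<and> ?p i > ?p j}
      = ?I \<union> ?J \<times> {Suc n}"
    by (auto simp: append_value_def le_Suc_eq) (auto simp: shift_def split: if_splits)
  have "?I \<subseteq> {1..n} \<times> {1..n}" by auto
  then have fin: "finite ?I" by (rule finite_subset) simp
  have "q ` ?J = {v..n}"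
  proof (intro set_eqI iffI)
    fix y assume "y \<in> q ` ?J"
    then show "y \<in> {v..n}" using permutes_le[OF q] by auto
  next
    fix y assume y: "y \<in> {v..n}"
    then have "y \<in> q ` {1..n}" using permutes_image[OF q] v by auto
    then show "y \<in> q ` ?J" using y by auto
  qed
  moreover have "inj_on q ?J" using permutes_inj[OF q] by (rule inj_on_subset) simp
  ultimately have "card ?J = Suc n - v"
    by (metis card_image card_atLeastAtMost)
  moreover have "card (?I \<union> ?J \<times> {Suc n}) = card ?I + card (?J \<times> {Suc n})"
    using fin by (intro card_Un_disjoint) auto
  ultimately show ?thesis
    unfolding inv_count_def eq by (simp add: card_cartesian_product)
qed

section \<open>Inversion weights of sets of permutations\<close>

definition weight :: "real \<Rightarrow> nat \<Rightarrow> ((nat \<Rightarrow> nat) \<Rightarrow> bool) \<Rightarrow> real" where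
  "weight \<theta> n Q = (\<Sum>p | p permutes {1..n} \<and> Q p. \<theta> ^ inv_count n p)"

lemma weight_cong:
  assumes "\<And>q. q permutes {1..n} \<Longrightarrow> Q q \<longleftrightarrow> R q"
  shows "weight \<theta> n Q = weight \<theta> n R"
  unfolding weight_def using assms by (intro sum.cong) auto

lemma weight_False [simp]: "weight \<theta> n (\<lambda>q. False) = 0"
  by (simp add: weight_def)

text \<open>Moving \<open>Q\<close> into the summand makes the index set all permutations, so that
  the sum can be reindexed along \<open>bij_betw_append_value\<close>.\<close>

lemma weight_eq_sum_if:
  "weight \<theta> n Q = (\<Sum>p | p permutes {1..n}. if Q p then \<theta> ^ inv_count n p else 0)"
  unfolding weight_def
  using sum.inter_filter[of "{p. p permutes {1..n}}" "\<lambda>p. \<theta> ^ inv_count n p" Q]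
  by (simp add: finite_permutations)

text \<open>Classifies permutations by their last value \<open>v\<close>, with the power of \<theta>
  paying for the inversions that \<open>v\<close> creates. The recursions for weights below are
  obtained by working out \<open>Q (append_value n v q)\<close> for each \<open>v\<close>.\<close>

lemma weight_Suc:
  "weight \<theta> (Suc n) Q =
     (\<Sum>v=1..Suc n. \<theta> ^ (Suc n - v) * weight \<theta> n (\<lambda>q. Q (append_value n v q)))"
proof -
  let ?g = "\<lambda>p. if Q p then \<theta> ^ inv_count (Suc n) p else 0"
  have "weight \<theta> (Suc n) Q = (\<Sum>p | p permutes {1..Suc n}. ?g p)"
    by (rule weight_eq_sum_if)
  also have "\<dots> = (\<Sum>(v, q) \<in> {1..Suc n} \<times> {q. q permutes {1..n}}. ?g (append_value n v q))"
    by (subst sum.reindex_bij_betw[OF bij_betw_append_value, symmetric])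
      (rule sum.cong[OF refl], clarify)
  also have "\<dots> = (\<Sum>v=1..Suc n. \<Sum>q | q permutes {1..n}. ?g (append_value n v q))"
    by (simp only: sum.cartesian_product)
  also have "\<dots> = (\<Sum>v=1..Suc n. \<theta> ^ (Suc n - v) * weight \<theta> n (\<lambda>q. Q (append_value n v q)))"
  proof (rule sum.cong[OF refl])
    fix v assume v: "v \<in> {1..Suc n}"
    have "(\<Sum>q | q permutes {1..n}. ?g (append_value n v q)) =
        (\<Sum>q | q permutes {1..n}. if Q (append_value n v q)
           then \<theta> ^ (Suc n - v) * \<theta> ^ inv_count n q else 0)"
      by (rule sum.cong[OF refl])
        (use v in \<open>auto simp: inv_count_append_value add.commute simp flip: power_add\<close>)
    also have "\<dots> = \<theta> ^ (Suc n - v) * weight \<theta> n (\<lambda>q. Q (append_value n v q))"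
      unfolding weight_eq_sum_if sum_distrib_left by (intro sum.cong) auto
    finally show "(\<Sum>q | q permutes {1..n}. ?g (append_value n v q)) =
      \<theta> ^ (Suc n - v) * weight \<theta> n (\<lambda>q. Q (append_value n v q))" .
  qed
  finally show ?thesis .
qed

text \<open>The exponents run from \<open>n - 1\<close> down to \<open>n - m\<close>. With last
  values stopping one or two short of the largest, this produces the factors \<theta> and \<theta>
  squared in the recursions.\<close>

lemma sum_power_diff:
  assumes "m \<le> n"
  shows "(\<Sum>v=1..m. \<theta> ^ (n - v)) = \<theta> ^ (n - m) * P \<theta> m"
  unfolding P_def sum_distrib_left power_add[symmetric]
  by (rule sum.reindex_bij_witness[where i = "\<lambda>i. m - i" and j = "\<lambda>v. m - v"])
    (use assms in auto)

lemma Pfact_0 [simp]: "Pfact \<theta> 0 = 1"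
  by (simp add: Pfact_def)

lemma Pfact_Suc: "Pfact \<theta> (Suc n) = P \<theta> (Suc n) * Pfact \<theta> n"
  by (simp add: Pfact_def)

lemma P_add: "P \<theta> (n + m) = \<theta> ^ m * P \<theta> n + P \<theta> m"
  by (induction n) (auto simp: P_def power_add algebra_simps)

text \<open>Positivity of \<theta> enters here; it later permits cancelling a factor
  \<open>Pfact\<close>.\<close>

lemma Pfact_pos:
  assumes "\<theta> > 0"
  shows "Pfact \<theta> n > 0"
  unfolding Pfact_def P_def using assms
  by (intro prod_pos ballI sum_pos) (auto simp: lessThan_empty_iff)

text \<open>The classical product formula for the inversion generating function:
  \<open>Pfact\<close> is the \<theta>-factorial, and the choice of the last value contributes the
  factor \<open>P \<theta> (Suc n)\<close>.\<close>

lemma weight_True: "weight \<theta> n (\<lambda>q. True) = Pfact \<theta> n"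
proof (induction n)
  case 0
  then show ?case by (simp add: weight_def inv_count_def)
next
  case (Suc n)
  have "weight \<theta> (Suc n) (\<lambda>q. True) = (\<Sum>v=1..Suc n. \<theta> ^ (Suc n - v)) * Pfact \<theta> n"
    by (simp only: weight_Suc Suc.IH sum_distrib_right)
  then show ?case
    by (simp only: sum_power_diff[OF order_refl] Pfact_Suc) simp
qed

section \<open>The position selected by the strategy\<close>

lemma lr_max_append_value:
  assumes "i \<le> n"
  shows "lr_max (append_value n v q) i \<longleftrightarrow> lr_max q i"
  using assms by (auto simp: lr_max_def append_value_def)

text \<open>Unlike \<open>strategy1\<close>, this carries no size, so the same predicate can be
  compared before and after a value is appended.\<close>

definition selects :: "nat \<Rightarrow> (nat \<Rightarrow> nat) \<Rightarrow> nat \<Rightarrow> bool" where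
  "selects k p i \<longleftrightarrow> k < i \<and> lr_max p i \<and> (\<forall>j\<in>{k+1..<i}. \<not> lr_max p j)"

lemma strategy1_eq_Some_iff: "strategy1 k n p = Some i \<longleftrightarrow> i \<le> n \<and> selects k p i"
proof
  assume eq: "strategy1 k n p = Some i"
  let ?R = "\<lambda>i. i \<in> {k+1..n} \<and> lr_max p i"
  from eq have ex: "\<exists>i. ?R i" and i: "i = (LEAST i. ?R i)"
    by (auto simp: strategy1_def split: if_splits)
  have "?R i" unfolding i using ex by (rule LeastI_ex)
  moreover have "\<not> ?R j" if "j < i" for j
    using that unfolding i by (rule not_less_Least)
  ultimately show "i \<le> n \<and> selects k p i" by (fastforce simp: selects_def)
next
  assume i: "i \<le> n \<and> selects k p i"
  then have "(LEAST i. i \<in> {k+1..n} \<and> lr_max p i) = i"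
    by (intro Least_equality) (auto simp: selects_def not_less[symmetric])
  moreover have "\<exists>i\<in>{k+1..n}. lr_max p i"
    using i by (auto simp: selects_def)
  ultimately show "strategy1 k n p = Some i"
    by (simp only: strategy1_def if_True)
qed

lemma winnable_iff: "winnable k n p \<longleftrightarrow> (\<exists>i\<le>n. selects k p i \<and> p i = n - 1)"
  by (auto simp: winnable_def strategy1_eq_Some_iff)

lemma pickable_iff: "pickable k n p \<longleftrightarrow> (\<exists>i\<in>{k+1..n}. lr_max p i)"
  by (simp add: pickable_def strategy1_def)

lemma selects_append_value:
  assumes "i \<le> n"
  shows "selects k (append_value n v q) i \<longleftrightarrow> selects k q i"
  using assms by (auto simp: selects_def lr_max_append_value)

text \<open>With \<open>v \<le> n\<close> the old maximum \<open>n\<close> is relabelled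
  \<open>Suc n\<close> and stands before the last position, which is therefore no left-to-right
  maximum.\<close>

lemma not_selects_append_value_last:
  assumes q: "q permutes {1..n}" and "n \<ge> 1" "v \<le> n"
  shows "\<not> selects k (append_value n v q) (Suc n)"
proof -
  obtain j where j: "j \<in> {1..n}" "q j = n"
    using permutes_image[OF q] \<open>n \<ge> 1\<close> by (metis atLeastAtMost_iff image_iff order_refl)
  then have "append_value n v q (Suc n) < append_value n v q j"
    using \<open>v \<le> n\<close> by (auto simp: append_value_def shift_def)
  moreover have "j \<in> {1..<Suc n}" using j(1) by simp
  ultimately show ?thesis
    unfolding selects_def lr_max_def using less_asym by blast
qed

section \<open>Permutations on which the strategy selects the maximum\<close>

definition selected_max_weight :: "real \<Rightarrow> nat \<Rightarrow> nat \<Rightarrow> nat \<Rightarrow> real" where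
  "selected_max_weight \<theta> k n i = weight \<theta> n (\<lambda>q. selects k q i \<and> q i = n)"

text \<open>A final maximum is always a left-to-right maximum and creates no inversion; the strategy
  reaches it exactly when it picks nothing before, that is, when the prefix is not pickable.\<close>

lemma selected_max_weight_last:
  assumes "k \<le> n"
  shows "selected_max_weight \<theta> k (Suc n) (Suc n) = T1 \<theta> n k"
proof -
  have "weight \<theta> n (\<lambda>q. selects k (append_value n v q) (Suc n) \<and> append_value n v q (Suc n) = Suc n)
      = (if v = Suc n then T1 \<theta> n k else 0)" for v
  proof (cases "v = Suc n")
    case True
    have "weight \<theta> n (\<lambda>q. selects k (append_value n v q) (Suc n) \<and> append_value n v q (Suc n) = Suc n)
        = weight \<theta> n (\<lambda>q. \<not> pickable k n q)"
    proof (rule weight_cong)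
      fix q assume q: "q permutes {1..n}"
      have "lr_max (append_value n (Suc n) q) (Suc n)"
        using permutes_le[OF q] by (auto simp: lr_max_def append_value_def shift_def less_Suc_eq_le)
      then show "selects k (append_value n v q) (Suc n) \<and> append_value n v q (Suc n) = Suc n
          \<longleftrightarrow> \<not> pickable k n q"
        using assms True
        by (auto simp: selects_def pickable_iff lr_max_append_value append_value_def)
    qed
    then show ?thesis using True by (simp add: T1_def weight_def)
  qed (simp add: append_value_def)
  then show ?thesis
    by (simp add: selected_max_weight_def weight_Suc)
qed

text \<open>Any last value \<open>v \<le> n\<close> lifts the old maximum \<open>n\<close> to
  \<open>Suc n\<close>, whereas \<open>v = Suc n\<close> takes the maximum away from position
  \<open>i\<close>. The admissible values contribute \<theta> + ... + \<theta>^n.\<close>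

lemma selected_max_weight_Suc:
  assumes "i \<le> n"
  shows "selected_max_weight \<theta> k (Suc n) i = \<theta> * P \<theta> n * selected_max_weight \<theta> k n i"
proof -
  let ?Q = "\<lambda>v q. selects k (append_value n v q) i \<and> append_value n v q i = Suc n"
  have top: "weight \<theta> n (?Q (Suc n)) = 0"
    using weight_cong[of n "?Q (Suc n)" "\<lambda>q. False"] permutes_le[of _ n i] assms
    by (auto simp: append_value_def shift_def split: if_splits)
  have below: "weight \<theta> n (?Q v) = selected_max_weight \<theta> k n i" if "v \<in> {1..n}" for v
    unfolding selected_max_weight_def
    by (rule weight_cong)
      (use assms that in \<open>auto simp: selects_append_value[OF assms] append_value_def shift_def\<close>)
  have "selected_max_weight \<theta> k (Suc n) i = (\<Sum>v=1..Suc n. \<theta> ^ (Suc n - v) * weight \<theta> n (?Q v))"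
    unfolding selected_max_weight_def by (rule weight_Suc)
  also have "\<dots> = (\<Sum>v=1..n. \<theta> ^ (Suc n - v) * weight \<theta> n (?Q v))"
    using top by simp
  also have "\<dots> = (\<Sum>v=1..n. \<theta> ^ (Suc n - v)) * selected_max_weight \<theta> k n i"
    using below by (simp add: sum_distrib_right)
  finally show ?thesis using sum_power_diff[of n "Suc n" \<theta>] by simp
qed

section \<open>Ordered partitions and Gaussian binomial coefficients\<close>

lemma card_cross_inversions_insert_max:
  assumes "finite A" "finite C" "\<forall>x\<in>A \<union> C. x < (t::nat)"
  shows "card {(a, b). a \<in> insert t A \<and> b \<in> C \<and> a > b} =
      card C + card {(a, b). a \<in> A \<and> b \<in> C \<and> a > b}" (is ?left)
    and "card {(a, b). a \<in> A \<and> b \<in> insert t C \<and> a > b} =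
      card {(a, b). a \<in> A \<and> b \<in> C \<and> a > b}" (is ?right)
proof -
  let ?X = "{(a, b). a \<in> A \<and> b \<in> C \<and> a > b}"
  have fin: "finite ?X"
    by (rule finite_subset[of _ "A \<times> C"]) (use assms in auto)
  have "{(a, b). a \<in> insert t A \<and> b \<in> C \<and> a > b} = {t} \<times> C \<union> ?X"
    using assms(3) by auto
  moreover have "card ({t} \<times> C \<union> ?X) = card ({t} \<times> C) + card ?X"
    using fin assms by (intro card_Un_disjoint) auto
  ultimately show ?left by (simp add: card_cartesian_product)
  have "{(a, b). a \<in> A \<and> b \<in> insert t C \<and> a > b} = ?X"
    using assms(3) by (auto dest: less_asym)
  then show ?right by simp
qed

lemma finite_ordered_partitions: "finite (ordered_partitions n m)"
  by (rule finite_subset[of _ "Pow {1..n+m} \<times> Pow {1..n+m}"]) (auto simp: ordered_partitions_def)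

text \<open>Splits according to the block that contains the largest element, in preparation for a
  Pascal rule.\<close>

lemma ordered_partitions_Suc_Suc:
  defines "t \<equiv> \<lambda>n m. Suc (Suc (n + m))"
  shows "ordered_partitions (Suc n) (Suc m) =
     (\<lambda>(A, C). (insert (t n m) A, C)) ` ordered_partitions n (Suc m) \<union>
     (\<lambda>(A, C). (A, insert (t n m) C)) ` ordered_partitions (Suc n) m"
  (is "?L = ?R")
proof (intro set_eqI iffI)
  let ?t = "t n m"
  fix x assume x: "x \<in> ?L"
  obtain A C where [simp]: "x = (A, C)" by (cases x)
  from x have un: "A \<union> C = {1..?t}" and dis: "A \<inter> C = {}"
    and cA: "card A = Suc n" and cC: "card C = Suc m"
    by (auto simp: ordered_partitions_def t_def)
  have "?t \<in> A \<union> C" unfolding un by (simp add: t_def)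
  then consider "?t \<in> A" "?t \<notin> C" | "?t \<in> C" "?t \<notin> A" using dis by blast
  then show "x \<in> ?R"
  proof cases
    case 1
    have "(A - {?t}) \<union> C = (A \<union> C) - {?t}" using 1 by auto
    also have "\<dots> = {1..n + Suc m}" unfolding un by (auto simp: t_def)
    finally have "(A - {?t}, C) \<in> ordered_partitions n (Suc m)"
      using 1 dis cA cC by (auto simp: ordered_partitions_def)
    moreover have "insert ?t (A - {?t}) = A" using 1 by auto
    ultimately show ?thesis by (force intro!: image_eqI)
  next
    case 2
    have "A \<union> (C - {?t}) = (A \<union> C) - {?t}" using 2 by auto
    also have "\<dots> = {1..Suc n + m}" unfolding un by (auto simp: t_def)
    finally have "(A, C - {?t}) \<in> ordered_partitions (Suc n) m"
      using 2 dis cA cC by (auto simp: ordered_partitions_def)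
    moreover have "insert ?t (C - {?t}) = C" using 2 by auto
    ultimately show ?thesis by (force intro!: image_eqI)
  qed
next
  let ?t = "t n m"
  fix x assume "x \<in> ?R"
  then consider A C where "x = (insert ?t A, C)" "(A, C) \<in> ordered_partitions n (Suc m)"
    | A C where "x = (A, insert ?t C)" "(A, C) \<in> ordered_partitions (Suc n) m"
    by auto
  then show "x \<in> ?L"
  proof cases
    case (1 A C)
    then have AC: "A \<union> C = {1..n + Suc m}" by (simp add: ordered_partitions_def)
    have "finite A" "?t \<notin> A" "?t \<notin> C"
      using AC finite_Un[of A C] Un_iff[of ?t A C] by (simp_all add: t_def)
    moreover have "insert ?t (A \<union> C) = {1..Suc n + Suc m}" unfolding AC by (auto simp: t_def)
    ultimately show ?thesis using 1 by (auto simp: ordered_partitions_def)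
  next
    case (2 A C)
    then have AC: "A \<union> C = {1..Suc n + m}" by (simp add: ordered_partitions_def)
    have "finite C" "?t \<notin> A" "?t \<notin> C"
      using AC finite_Un[of A C] Un_iff[of ?t A C] by (simp_all add: t_def)
    moreover have "insert ?t (A \<union> C) = {1..Suc n + Suc m}" unfolding AC by (auto simp: t_def)
    ultimately show ?thesis using 2 by (auto simp: ordered_partitions_def)
  qed
qed

lemma ordered_partitionsD:
  assumes "(A, C) \<in> ordered_partitions n m"
  shows "finite A" "finite C" "card A = n" "card C = m" "\<forall>x\<in>A \<union> C. x \<le> n + m"
proof -
  from assms have AC: "A \<union> C = {1..n + m}" by (simp add: ordered_partitions_def)
  then show "finite A" "finite C" "\<forall>x\<in>A \<union> C. x \<le> n + m"
    using finite_Un[of A C] by simp_all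
  show "card A = n" "card C = m" using assms by (simp_all add: ordered_partitions_def)
qed

text \<open>The \<theta>-Pascal rule: in the first block the largest element exceeds all
  \<open>Suc m\<close> elements of the second, while in the second block it adds no cross
  inversion.\<close>

lemma B_Suc_Suc: "B \<theta> (Suc n) (Suc m) = \<theta> ^ Suc m * B \<theta> n (Suc m) + B \<theta> (Suc n) m"
proof -
  let ?t = "Suc (Suc (n + m))"
  let ?f = "\<lambda>(A, C). (insert ?t A, C)" and ?g = "\<lambda>(A, C). (A, insert ?t C)"
  let ?w = "\<lambda>(A, C). \<theta> ^ card {(a, b). a \<in> A \<and> b \<in> C \<and> a > b}"
  let ?X = "ordered_partitions n (Suc m)" and ?Y = "ordered_partitions (Suc n) m"
  \<comment> \<open>Since \<open>?t\<close> is absent from the smaller partitions, inserting it is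
    injective, and the images under \<open>?f\<close> and \<open>?g\<close> are disjoint.\<close>
  have X: "?t \<notin> A \<and> ?t \<notin> C" if "(A, C) \<in> ?X" for A C
    using ordered_partitionsD(5)[OF that] by force
  have Y: "?t \<notin> A \<and> ?t \<notin> C" if "(A, C) \<in> ?Y" for A C
    using ordered_partitionsD(5)[OF that] by force
  have injf: "inj_on ?f ?X"
    using X by (auto simp: inj_on_def insert_ident)
  have injg: "inj_on ?g ?Y"
    using Y by (auto simp: inj_on_def insert_ident)
  have "B \<theta> (Suc n) (Suc m) = (\<Sum>x \<in> ?f ` ?X \<union> ?g ` ?Y. ?w x)"
    unfolding B_def ordered_partitions_Suc_Suc ..
  also have "\<dots> = (\<Sum>x \<in> ?f ` ?X. ?w x) + (\<Sum>x \<in> ?g ` ?Y. ?w x)"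
    using X Y by (intro sum.union_disjoint) (auto simp: finite_ordered_partitions)
  also have "(\<Sum>x \<in> ?f ` ?X. ?w x) = (\<Sum>x \<in> ?X. \<theta> ^ Suc m * ?w x)"
    unfolding sum.reindex[OF injf]
  proof (rule sum.cong[OF refl], clarify)
    fix A C assume "(A, C) \<in> ?X"
    note D = ordered_partitionsD[OF this]
    from D(5) have "\<forall>x\<in>A \<union> C. x < ?t" by (simp add: less_Suc_eq_le)
    from card_cross_inversions_insert_max(1)[OF D(1,2) this] D(4)
    show "(?w \<circ> ?f) (A, C) = \<theta> ^ Suc m * \<theta> ^ card {(a, b). a \<in> A \<and> b \<in> C \<and> a > b}"
      by (simp add: power_add)
  qed
  also have "\<dots> = \<theta> ^ Suc m * B \<theta> n (Suc m)"
    by (simp only: B_def sum_distrib_left)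
  also have "(\<Sum>x \<in> ?g ` ?Y. ?w x) = (\<Sum>x \<in> ?Y. ?w x)"
    unfolding sum.reindex[OF injg]
  proof (rule sum.cong[OF refl], clarify)
    fix A C assume "(A, C) \<in> ?Y"
    note D = ordered_partitionsD[OF this]
    from D(5) have "\<forall>x\<in>A \<union> C. x < ?t" by (simp add: less_Suc_eq_le)
    from card_cross_inversions_insert_max(2)[OF D(1,2) this]
    show "(?w \<circ> ?g) (A, C) = \<theta> ^ card {(a, b). a \<in> A \<and> b \<in> C \<and> a > b}"
      by simp
  qed
  also have "\<dots> = B \<theta> (Suc n) m"
    by (simp only: B_def)
  finally show ?thesis .
qed

lemma B_0_right: "B \<theta> n 0 = 1"
proof -
  have "ordered_partitions n 0 = {({1..n}, {})}"
  proof (intro set_eqI iffI)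
    fix x assume x: "x \<in> ordered_partitions n 0"
    obtain A C where [simp]: "x = (A, C)" by (cases x)
    have "C = {}" using ordered_partitionsD(2,4)[of A C n 0] x by simp
    then show "x \<in> {({1..n}, {})}" using x by (simp add: ordered_partitions_def)
  qed (simp add: ordered_partitions_def)
  then show ?thesis by (simp add: B_def)
qed

lemma B_0_left: "B \<theta> 0 m = 1"
proof -
  have "ordered_partitions 0 m = {({}, {1..m})}"
  proof (intro set_eqI iffI)
    fix x assume x: "x \<in> ordered_partitions 0 m"
    obtain A C where [simp]: "x = (A, C)" by (cases x)
    have "A = {}" using ordered_partitionsD(1,3)[of A C 0 m] x by simp
    then show "x \<in> {({}, {1..m})}" using x by (simp add: ordered_partitions_def)
  qed (simp add: ordered_partitions_def)
  then show ?thesis by (simp add: B_def)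
qed

text \<open>The factorial formula for Gaussian binomials, without division. Both terms of the Pascal
  rule have a smaller index sum, hence the induction on \<open>n + m\<close>.\<close>

lemma B_mult_Pfact: "B \<theta> n m * Pfact \<theta> n * Pfact \<theta> m = Pfact \<theta> (n + m)"
proof (induction "n + m" arbitrary: n m rule: less_induct)
  case less
  show ?case
  proof (cases "n = 0 \<or> m = 0")
    case True
    then show ?thesis by (auto simp: B_0_left B_0_right)
  next
    case False
    then obtain a b where [simp]: "n = Suc a" "m = Suc b"
      by (metis not0_implies_Suc)
    have 1: "B \<theta> a (Suc b) * Pfact \<theta> a * Pfact \<theta> (Suc b) = Pfact \<theta> (Suc (a + b))"
      using less[of a "Suc b"] by simp
    have 2: "B \<theta> (Suc a) b * Pfact \<theta> (Suc a) * Pfact \<theta> b = Pfact \<theta> (Suc (a + b))"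
      using less[of "Suc a" b] by simp
    \<comment> \<open>The top factor of \<open>Pfact \<theta> n\<close> is split off in the first
      term and that of \<open>Pfact \<theta> m\<close> in the second, so that the induction
      hypotheses give both the same factor; \<open>P_add\<close> then recombines the
      coefficients.\<close>
    have "B \<theta> n m * Pfact \<theta> n * Pfact \<theta> m =
        \<theta> ^ Suc b * P \<theta> (Suc a) * (B \<theta> a (Suc b) * Pfact \<theta> a * Pfact \<theta> (Suc b))
        + P \<theta> (Suc b) * (B \<theta> (Suc a) b * Pfact \<theta> (Suc a) * Pfact \<theta> b)"
      by (simp add: B_Suc_Suc Pfact_Suc[of \<theta> a] Pfact_Suc[of \<theta> b] algebra_simps)
    also have "\<dots> = (\<theta> ^ Suc b * P \<theta> (Suc a) + P \<theta> (Suc b)) * Pfact \<theta> (Suc (a + b))"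
      unfolding 1 2 by (simp add: algebra_simps)
    also have "\<dots> = P \<theta> (Suc (Suc (a + b))) * Pfact \<theta> (Suc (a + b))"
      using P_add[of \<theta> "Suc a" "Suc b"] by simp
    finally show ?thesis by (simp add: Pfact_Suc)
  qed
qed

section \<open>Closed form for selecting the maximum at a given position\<close>

lemma selected_max_weight_eq:
  assumes "\<theta> > 0" "k < i"
  shows "selected_max_weight \<theta> k (i + d) i = \<theta> ^ d * T1 \<theta> (i - 1) k * B \<theta> (i - 1) d * Pfact \<theta> d"
proof -
  obtain j where i [simp]: "i = Suc j" using assms by (cases i) auto
  \<comment> \<open>The \<open>d\<close> values appended after position \<open>i\<close> contribute
    the factors \<open>P\<close> with indices from \<open>j + 1\<close> to \<open>j + d\<close>.
    Multiplying by \<open>Pfact \<theta> j\<close> completes them to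
    \<open>Pfact \<theta> (j + d)\<close>, where \<open>B_mult_Pfact\<close> applies.\<close>
  have "selected_max_weight \<theta> k (i + d) i * Pfact \<theta> j = \<theta> ^ d * T1 \<theta> j k * Pfact \<theta> (j + d)"
  proof (induction d)
    case 0
    then show ?case using selected_max_weight_last[of k j \<theta>] assms by simp
  next
    case (Suc d)
    then show ?case
      using selected_max_weight_Suc[of i "i + d" \<theta> k] Pfact_Suc[of \<theta> "j + d"]
      by (simp add: algebra_simps)
  qed
  also have "\<dots> = \<theta> ^ d * T1 \<theta> j k * B \<theta> j d * Pfact \<theta> d * Pfact \<theta> j"
    unfolding B_mult_Pfact[symmetric] by simp
  finally show ?thesis
    using Pfact_pos[OF assms(1), of j] by simp
qed

section \<open>The recursion for winnable permutations\<close>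

lemma winnable_append_value_max:
  assumes q: "q permutes {1..n}"
  shows "winnable k (Suc n) (append_value n (Suc n) q) \<longleftrightarrow>
    (\<exists>i\<in>{k+1..n}. selects k q i \<and> q i = n)"
proof -
  \<comment> \<open>Appending \<open>Suc n\<close> relabels nothing, so the winning value
    \<open>n\<close> of the longer permutation is the maximum of \<open>q\<close>; the last position
    holds \<open>Suc n\<close> and cannot win.\<close>
  have "append_value n (Suc n) q i = q i" if "i \<le> n" for i
    using permutes_le[OF q that] that by (simp add: append_value_def shift_def)
  then have "winnable k (Suc n) (append_value n (Suc n) q) \<longleftrightarrow>
      (\<exists>i\<le>n. selects k q i \<and> q i = n)"
    by (auto simp: winnable_iff le_Suc_eq selects_append_value append_value_def)
  also have "\<dots> \<longleftrightarrow> (\<exists>i\<in>{k+1..n}. selects k q i \<and> q i = n)"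
    by (auto simp: selects_def)
  finally show ?thesis .
qed

text \<open>For \<open>v < n\<close> the shift lifts exactly \<open>n - 1\<close> to
  \<open>n\<close>, so the second largest value keeps its position, and the strategy never selects
  the last position.\<close>

lemma winnable_append_value_below:
  assumes q: "q permutes {1..n}" and v: "1 \<le> v" "v < n"
  shows "winnable k (Suc n) (append_value n v q) \<longleftrightarrow> winnable k n q"
proof -
  have "append_value n v q i = n \<longleftrightarrow> q i = n - 1" if "i \<le> n" for i
    using v that by (auto simp: append_value_def shift_def)
  then show ?thesis
    using not_selects_append_value_last[OF q, of v k] v
    by (auto simp: winnable_iff le_Suc_eq[of _ n] selects_append_value)
qed

text \<open>The winning value \<open>n\<close> stands in the last position, after
  \<open>Suc n\<close>, where the strategy cannot select it.\<close>

lemma not_winnable_append_value_second: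
  assumes q: "q permutes {1..n}" and "n \<ge> 1"
  shows "\<not> winnable k (Suc n) (append_value n n q)"
proof -
  have "append_value n n q i \<noteq> n" if "i \<le> n" for i
    using that by (simp add: append_value_def)
  then show ?thesis
    using not_selects_append_value_last[OF q, of n k] assms(2)
    by (auto simp: winnable_iff le_Suc_eq[of _ n])
qed

text \<open>The cases for different \<open>i\<close> are disjoint because \<open>q\<close> is
  injective and takes the value \<open>n\<close> only once.\<close>

lemma weight_Bex_selected_max:
  "weight \<theta> n (\<lambda>q. \<exists>i\<in>{k+1..n}. selects k q i \<and> q i = n) =
    (\<Sum>i=k+1..n. selected_max_weight \<theta> k n i)"
proof -
  let ?S = "\<lambda>i. {q. q permutes {1..n} \<and> selects k q i \<and> q i = n}"
  have fin: "finite (?S i)" for i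
    by (rule finite_subset[OF _ finite_permutations[of "{1..n}"]]) auto
  have dis: "?S i \<inter> ?S j = {}" if "i \<noteq> j" for i j
    using that by (auto dest: permutes_inj injD)
  have "{q. q permutes {1..n} \<and> (\<exists>i\<in>{k+1..n}. selects k q i \<and> q i = n)} =
      (\<Union>i\<in>{k+1..n}. ?S i)"
    by auto
  then show ?thesis
    unfolding weight_def selected_max_weight_def
    using fin dis by (simp add: sum.UNION_disjoint)
qed

lemma W1_star_eq_weight: "W1_star \<theta> n k = weight \<theta> n (winnable k n)"
  by (simp add: W1_star_def weight_def)

text \<open>Stated for all \<open>n \<ge> 1\<close>, so that both initial conditions can be read off
  as well, at \<open>n = k\<close> and \<open>n = k + 1\<close>.\<close>

lemma W1_star_Suc:
  assumes "\<theta> > 0" "n \<ge> 1"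
  shows "W1_star \<theta> (Suc n) k = \<theta>\<^sup>2 * P \<theta> (n - 1) * W1_star \<theta> n k
    + (\<Sum>i=k+1..n. \<theta> ^ (n - i) * T1 \<theta> (i - 1) k * B \<theta> (i - 1) (n - i) * Pfact \<theta> (n - i))"
proof -
  obtain m where n [simp]: "n = Suc m" using assms by (cases n) auto
  let ?w = "\<lambda>v. weight \<theta> n (\<lambda>q. winnable k (Suc n) (append_value n v q))"
  have "W1_star \<theta> (Suc n) k = (\<Sum>v=1..Suc n. \<theta> ^ (Suc n - v) * ?w v)"
    unfolding W1_star_eq_weight by (rule weight_Suc)
  \<comment> \<open>The three cases are a last value below the second largest, equal to it, and
    equal to the maximum.\<close>
  also have "\<dots> = (\<Sum>v=1..m. \<theta> ^ (Suc n - v) * ?w v) + \<theta> * ?w n + ?w (Suc n)"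
    by simp
  also have "?w n = 0"
    using weight_cong[of n _ "\<lambda>q. False"] not_winnable_append_value_second assms(2) by simp
  also have "(\<Sum>v=1..m. \<theta> ^ (Suc n - v) * ?w v) = (\<Sum>v=1..m. \<theta> ^ (Suc n - v)) * W1_star \<theta> n k"
    unfolding sum_distrib_right W1_star_eq_weight
    by (intro sum.cong arg_cong2[where f = "(*)"] weight_cong winnable_append_value_below refl) auto
  also have "(\<Sum>v=1..m. \<theta> ^ (Suc n - v)) = \<theta>\<^sup>2 * P \<theta> (n - 1)"
    using sum_power_diff[of m "Suc n" \<theta>] by simp
  also have "?w (Suc n) = (\<Sum>i=k+1..n. selected_max_weight \<theta> k n i)"
    unfolding weight_Bex_selected_max[symmetric]
    by (rule weight_cong) (rule winnable_append_value_max)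
  also have "\<dots> = (\<Sum>i=k+1..n. \<theta> ^ (n - i) * T1 \<theta> (i - 1) k * B \<theta> (i - 1) (n - i) * Pfact \<theta> (n - i))"
  proof (rule sum.cong[OF refl])
    fix i assume "i \<in> {k+1..n}"
    then show "selected_max_weight \<theta> k n i =
        \<theta> ^ (n - i) * T1 \<theta> (i - 1) k * B \<theta> (i - 1) (n - i) * Pfact \<theta> (n - i)"
      using selected_max_weight_eq[OF assms(1), of k i "n - i"] by simp
  qed
  finally show ?thesis by simp
qed

text \<open>At size \<open>k\<close> no position is left to pick from, so every permutation is
  counted.\<close>

lemma T1_self: "T1 \<theta> k k = Pfact \<theta> k"
  unfolding T1_def weight_True[symmetric] weight_def by (simp add: pickable_iff)

lemma W1_star_self:
  assumes "k \<ge> 1"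
  shows "W1_star \<theta> k k = 0"
proof -
  have "\<not> winnable k k p" for p
    by (auto simp: winnable_iff selects_def)
  then show ?thesis by (simp add: W1_star_def)
qed

theorem theorem10:
  fixes \<theta> :: real and k :: nat
  assumes "\<theta> > 0" and "k \<ge> 1"
  shows "(\<forall>N\<ge>k + 3.
            W1_star \<theta> N k =
              \<theta>\<^sup>2 * P \<theta> (N - 2) * W1_star \<theta> (N - 1) k
              + (\<Sum>i=k+1..N-1. \<theta> ^ (N - i - 1) * T1 \<theta> (i - 1) k
                                 * B \<theta> (i - 1) (N - i - 1) * Pfact \<theta> (N - i - 1)))
         \<and> W1_star \<theta> (k + 1) k = 0
         \<and> W1_star \<theta> (k + 2) k = Pfact \<theta> k"
proof (intro conjI allI impI)
  fix N assume "N \<ge> k + 3"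
  then obtain n where N: "N = Suc n" and n: "n \<ge> 1" by (cases N) auto
  have "N - i - 1 = n - i" "N - 1 = n" "N - 2 = n - 1" for i
    unfolding N by simp_all
  then show "W1_star \<theta> N k =
              \<theta>\<^sup>2 * P \<theta> (N - 2) * W1_star \<theta> (N - 1) k
              + (\<Sum>i=k+1..N-1. \<theta> ^ (N - i - 1) * T1 \<theta> (i - 1) k
                                 * B \<theta> (i - 1) (N - i - 1) * Pfact \<theta> (N - i - 1))"
    using W1_star_Suc[OF assms(1) n, of k] unfolding N by simp
next
  \<comment> \<open>At \<open>n = k\<close> the sum is empty and the other term vanishes by
    \<open>W1_star_self\<close>.\<close>
  show W: "W1_star \<theta> (k + 1) k = 0"
    using W1_star_Suc[OF assms, of k] W1_star_self[OF assms(2)] by simp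
  \<comment> \<open>At \<open>n = k + 1\<close> only \<open>i = k + 1\<close> remains, with zero
    exponent, leaving \<open>T1 \<theta> k k\<close>.\<close>
  show "W1_star \<theta> (k + 2) k = Pfact \<theta> k"
    using W1_star_Suc[OF assms(1), of "k + 1" k] W by (simp add: T1_self B_0_right)
qed

end
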